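(* Let $\{x_k\}_{k\ge 0}$ be the infinite sequence generated by the algorithm $\mathrm{SSARC_qK}$ (described in the context) applied to the problem of minimizing $f(x)$ over $x\in\mathbb R^n$ subject to $c(x)=0$. Assume: (A1) $f$ is uniformly bounded from below, and $g=\nabla f$ and $c$ are uniformly bounded; (A2) $g$, $c$ and $\nabla c_i$ ($i=1,\dots,p$) are Lipschitz continuous in some open set $\mathcal C\supseteq\{x_k\}$; (A3) there is a constant $\kappa_{\rm B}\ge 0$ with $\|B_k\|\le\kappa_{\rm B}$ for all $k$; (A4) there is a constant $\kappa_{\rm n}>0$ with $\|v_k^c\|\le\kappa_{\rm n}\|c(x_k)\|$ for all $k$; (A5) $Z_k^Tg_k$ is uniformly continuous on the sequence of iterates $\{x_k\}$, namely, $\|Z_{t_i}^Tg_{t_i}-Z_{l_i}^Tg_{l_i}\|\to0$ whenever $\|x_{t_i}-x_{l_i}\|\to0$ as $i\to\infty$, where $\{x_{t_i}\}$ and $\{x_{l_i}\}$ are subsequences of $\{x_k\}$. Then $$\lim_{k\to\infty}\|Z_k^Tg_k\|=0.$$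
   Context: Problem and notation. $f:\mathbb R^n\to\mathbb R$ and $c:\mathbb R^n\to\mathbb R^p$, $p\le n$, are sufficiently smooth; $g=\nabla f$; $J(x)$ is the $p\times n$ Jacobian of $c$; $\|\cdot\|$ is the Euclidean (and induced matrix) norm. Write $g_k=g(x_k)$, $c_k=c(x_k)$, $J_k=J(x_k)$. $B_k$ is the Hessian in $x$ of the Lagrangian $f(x)-s^Tc(x)$ at $(x_k,s_k)$, or a symmetric approximation of it. $J_k$ is assumed to have full row rank for all $k$. The columns of $Z_k$ form an orthonormal basis of the null space of $J_k$. A KKT (first-order critical) point is a point $x$ with $c(x)=0$ and $g(x)\in\operatorname{range}J(x)^T$. Parameters. $0<\eta_1<\eta_2<1$, $0<\gamma_1<1<\gamma_2$, $\nu\in(0,1)$, $\tau_1>1$, $\tau_2>0$, $\theta\in(0,1]$, $\xi>0$, $\zeta\in(0,1]$, $t\ge1$, positive integers $e_L,e_U$, and the shifts $\lambda_{(0)}=10^{-e_L/2}$, $\lambda_{(i+1)}=10^{1/2}\lambda_{(i)}$, $i=0,\dots,m$ with $m=e_L+e_U$, satisfying $10^{-e_L}\le\lambda_{(i)}\le10^{e_U}$. Start: $x_0\in\mathbb R^n$, $\beta_0>0$, $\mu_{-1}>0$, $k=0$. Shifted CG-Lanczos, for data $(B,b)$ ($B$ symmetric) and shift $\lambda$: set $w_0=0$, $a_0\upsilon_0=-b$ with $a_0>0$, $\|\upsilon_0\|=1$, $p_0=-b$, $\upsilon_{-1}=0$, $\sigma_0=a_0$, $\omega_{-1}=0$, $\pi_{-1}=1$.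 For $l=0,1,\dots$, while $\|b+(B+\lambda I)w_l\|>\xi\min\{\|b\|,\|w_l\|\}^{1+\zeta}$: $\delta_l=\upsilon_l^TB\upsilon_l$; $a_{l+1}\upsilon_{l+1}=B\upsilon_l-\delta_l\upsilon_l-a_l\upsilon_{l-1}$ with $a_{l+1}>0$, $\|\upsilon_{l+1}\|=1$; $\delta_l\leftarrow\delta_l+\lambda$; $\pi_l=1/(\delta_l-\omega_{l-1}/\pi_{l-1})$; break (negative curvature) if $\pi_l<0$; $\omega_l=(a_{l+1}\pi_l)^2$; $\sigma_{l+1}=-a_{l+1}\pi_l\sigma_l$; $w_{l+1}=w_l+\pi_lp_l$; $p_{l+1}=\sigma_{l+1}\upsilon_{l+1}+\omega_lp_l$. Output $u(\lambda)$: the final $w_l$. Functions. $\phi(x,\mu)=f(x)+\mu\|c(x)\|$ and $q(x,B,\mu,d)=f(x)+g(x)^Td+\frac12d^TBd+\mu\|c(x)+J(x)d\|$. Algorithm $\mathrm{SSARC_qK}$. While $x_k$ is not a KKT point, do the following (outer iteration $k$). (1) Vertical step, computed once per outer iteration: $v_k^c=-J_k^T(J_kJ_k^T)^{-1}c_k$, $v_k=\alpha_kv_k^c$ with $\alpha_k\in\left[\min\{1,\theta\sqrt{\beta_k}/\|v_k^c\|\},\ \min\{1,\sqrt{\beta_k}/\|v_k^c\|\}\right]$ (so $v_k=0$ if $c_k=0$). (2) With $g_k^Z=Z_k^T(g_k+B_kv_k)$ and $B_k^Z=Z_k^TB_kZ_k$, compute, once per outer iteration, $u(\lambda_{(i)})$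 for all shifts by shifted CG-Lanczos with data $(B_k^Z,g_k^Z)$ (approximate solution of $(B_k^Z+\lambda_{(i)}I)u=-g_k^Z$), and set $d(\lambda_{(i)})=v_k+Z_ku(\lambda_{(i)})$. (3) Let $i^+=\min\{0\le i\le m: B_k^Z+\lambda_{(i)}I\succ0\}$ (the smallest shift for which no negative curvature is detected) and let $j$ minimize $\left|\beta_k\lambda_{(i)}-\|u(\lambda_{(i)})\|\right|$ over $i^+\le i\le m$. (4) Inner loop, repeated until a trial step is accepted: (4a) Set $\lambda_k=\lambda_{(j)}$, $u_k=u(\lambda_{(j)})$, $h_k=Z_ku_k$ (horizontal step), $d_k=d(\lambda_{(j)})=v_k+h_k$. (4b) Put $\Delta q_k^N=\|c_k\|-\|c_k+J_kv_k\|$, $\Delta q_k^H=-(g_k+B_kv_k)^Th_k-\frac12h_k^TB_kh_k$, $\Delta q_k^F=-g_k^Tv_k-\frac12v_k^TB_kv_k$ and $\mu_k^c=-\dfrac{\Delta q_k^F+\Delta q_k^H}{(1-\nu)\Delta q_k^N}$; set $\mu_k=\max\{\mu_k^c,\tau_1\mu_{k-1},\mu_{k-1}+\tau_2\}$ if $\mu_{k-1}<\mu_k^c$, and $\mu_k=\mu_{k-1}$ otherwise (also if $\Delta q_k^N=0$). This enforces $\Delta q_k:=q(x_k,B_k,\mu_k,0)-q(x_k,B_k,\mu_k,d_k)=\Delta q_k^H+\mu_k\Delta q_k^N+\Delta q_k^F\ge\nu\mu_k\Delta q_k^N$. (4c) Compute $\rho_k=\dfrac{\phi(x_k,\mu_k)-\phi(x_k+d_k,\mu_k)}{\Delta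 q_k}$. (4d) If $\rho_k<\eta_1$ (trial rejected): set $\beta_{k+1}=\beta_k$, and while $\beta_{k+1}>\gamma_1\beta_k$ set $\beta_{k+1}=\|u(\lambda_{(j+1)})\|/\lambda_{(j+1)}$ and $j\leftarrow j+1$ (the sample of shifts is supposed to contain large enough values for this search to succeed); then return to (4a) with the new $j$. Neither $v_k$ nor any $u(\lambda_{(i)})$ is recomputed, and $k$ is not advanced. (4e) If $\rho_k\ge\eta_1$ (trial accepted): set $x_{k+1}=x_k+d_k$, update $B_{k+1}$, set $\beta_{k+1}=\gamma_2\beta_k$ if $\rho_k>\eta_2$ and $\beta_{k+1}=\beta_k$ otherwise, and leave the inner loop. (5) $k\leftarrow k+1$. Standing assumptions. The algorithm does not stop at a KKT point, so the sequence is infinite. For all $k$, with residual $r_k:=g_k^Z+(B_k^Z+\lambda_kI)u_k$, the pair $(\lambda_k,u_k)$ used at iteration $k$ satisfies $u_k^T(B_k^Z+\lambda_kI)u_k\ge0$, $\frac1t\frac{\|u_k\|}{\beta_k}\le\lambda_k\le t\frac{\|u_k\|}{\beta_k}$ and $\|r_k\|\le\xi\min\{\|g_k^Z\|,\|u_k\|\}^{1+\zeta}$; and $\beta_k\le\beta_{\max}$ for all $k\ge 0$ and some constant $\beta_{\max}>0$. *)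

theory Defs
  imports "HOL-Analysis.Analysis"
begin

section \<open>Shifted CG-Lanczos\<close>

text \<open>
  In the state of iteration \<open>l\<close>, \<open>lan\<close> is \<open>a\<^sub>l\<close>, \<open>ups\<close> and \<open>ups_prev\<close> are the Lanczos vectors number
  \<open>l\<close> and \<open>l - 1\<close>, \<open>omg_prev\<close> and \<open>piv_prev\<close> are \<open>\<omega>\<close> and \<open>\<pi>\<close> of index \<open>l - 1\<close>, and \<open>cgs\<close>, \<open>wvec\<close>,
  \<open>pvec\<close> are \<open>\<sigma>\<^sub>l\<close>, \<open>w\<^sub>l\<close>, \<open>p\<^sub>l\<close>.
\<close>

record ('n) cgl_state =
  ups_prev :: "real ^ ('n::finite)"
  lan      :: real
  ups      :: "real ^ 'n"
  omg_prev :: real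
  piv_prev :: real
  cgs      :: real
  wvec     :: "real ^ 'n"
  pvec     :: "real ^ 'n"

definition cgl_init :: "real ^ 'n \<Rightarrow> ('n::finite) cgl_state" where
  "cgl_init b = \<lparr> ups_prev = 0, lan = norm b, ups = (- b) /\<^sub>R norm b,
     omg_prev = 0, piv_prev = 1, cgs = norm b, wvec = 0, pvec = - b \<rparr>"

definition cgl_piv :: "real ^ 'n ^ 'n \<Rightarrow> real \<Rightarrow> ('n::finite) cgl_state \<Rightarrow> real" where
  "cgl_piv B lam s = 1 / ((ups s \<bullet> (B *v ups s) + lam) - omg_prev s / piv_prev s)"

text \<open>
  When the Lanczos recurrence breaks down (\<open>z = 0\<close> below) the next \<open>a\<close> and \<open>\<upsilon>\<close> are both \<open>0\<close>; the
  new \<open>w\<close> then solves the shifted system exactly, so the residual test stops the iteration.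
\<close>

definition cgl_step ::
  "real ^ 'n ^ 'n \<Rightarrow> real \<Rightarrow> ('n::finite) cgl_state \<Rightarrow> 'n cgl_state" where
  "cgl_step B lam s =
     (let delta = ups s \<bullet> (B *v ups s);
          z     = B *v ups s - delta *\<^sub>R ups s - lan s *\<^sub>R ups_prev s;
          a'    = norm z;
          ups'  = z /\<^sub>R a';
          pv    = cgl_piv B lam s;
          omg   = (a' * pv)\<^sup>2;
          cgs'  = - a' * pv * cgs s
      in \<lparr> ups_prev = ups s, lan = a', ups = ups', omg_prev = omg, piv_prev = pv,
           cgs = cgs', wvec = wvec s + pv *\<^sub>R pvec s,
           pvec = cgs' *\<^sub>R ups' + omg *\<^sub>R pvec s \<rparr>)"

text \<open>
  The iteration stops when the residual test is met or nonpositive curvature is detected. A zero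
  denominator in \<open>\<pi>\<^sub>l\<close> gives \<open>cgl_piv = 0\<close> and is treated as a break, too; neither kind of break
  can occur for a positive definite shifted matrix.
\<close>

definition cgl_stop ::
  "real \<Rightarrow> real \<Rightarrow> real ^ 'n ^ 'n \<Rightarrow> real ^ 'n \<Rightarrow> real \<Rightarrow> ('n::finite) cgl_state \<Rightarrow> bool" where
  "cgl_stop xi zeta B b lam s \<longleftrightarrow>
     \<not> norm (b + (B + mat lam) *v wvec s) > xi * min (norm b) (norm (wvec s)) powr (1 + zeta)
     \<or> cgl_piv B lam s \<le> 0"

definition cgl_iter ::
  "real ^ 'n ^ 'n \<Rightarrow> real ^ 'n \<Rightarrow> real \<Rightarrow> nat \<Rightarrow> ('n::finite) cgl_state" where
  "cgl_iter B b lam l = (cgl_step B lam ^^ l) (cgl_init b)"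

definition cg_lanczos ::
  "real \<Rightarrow> real \<Rightarrow> real ^ 'n ^ 'n \<Rightarrow> real ^ 'n \<Rightarrow> real \<Rightarrow> real ^ ('n::finite)" where
  "cg_lanczos xi zeta B b lam =
     wvec (cgl_iter B b lam (LEAST l. cgl_stop xi zeta B b lam (cgl_iter B b lam l)))"


section \<open>Ingredients of the algorithm\<close>

definition kkt_point ::
  "(real ^ 'n \<Rightarrow> real ^ 'n) \<Rightarrow> (real ^ 'n \<Rightarrow> real ^ 'p) \<Rightarrow> (real ^ 'n \<Rightarrow> real ^ 'n ^ 'p)
   \<Rightarrow> real ^ ('n::finite) \<Rightarrow> bool" where
  "kkt_point g c J y \<longleftrightarrow> c y = 0 \<and> g y \<in> range (\<lambda>s. transpose (J y) *v s)"

definition vertical_dir ::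
  "(real ^ 'n \<Rightarrow> real ^ 'p) \<Rightarrow> (real ^ 'n \<Rightarrow> real ^ 'n ^ 'p) \<Rightarrow> real ^ ('n::finite) \<Rightarrow> real ^ 'n"
  where
  "vertical_dir c J y =
     - (transpose (J y) *v (matrix_inv (J y ** transpose (J y)) *v c y))"

definition merit ::
  "(real ^ 'n \<Rightarrow> real) \<Rightarrow> (real ^ 'n \<Rightarrow> real ^ 'p) \<Rightarrow> real ^ ('n::finite) \<Rightarrow> real \<Rightarrow> real" where
  "merit f c y mu = f y + mu * norm (c y)"

definition qmodel ::
  "(real ^ 'n \<Rightarrow> real) \<Rightarrow> (real ^ 'n \<Rightarrow> real ^ 'n) \<Rightarrow> (real ^ 'n \<Rightarrow> real ^ 'p)
   \<Rightarrow> (real ^ 'n \<Rightarrow> real ^ 'n ^ 'p) \<Rightarrow> real ^ ('n::finite) \<Rightarrow> real ^ 'n ^ 'n \<Rightarrow> real \<Rightarrow> real ^ 'n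
   \<Rightarrow> real" where
  "qmodel f g c J y B mu d =
     f y + g y \<bullet> d + 1/2 * (d \<bullet> (B *v d)) + mu * norm (c y + J y *v d)"

text \<open>
  The reduced space of dimension \<open>n - p\<close>, which is \<open>0\<close> when \<open>n = p\<close> and so cannot be a type
  \<open>real ^ 'm\<close>, is represented by the vectors of \<open>real ^ 'n\<close> that vanish outside a fixed set \<open>I\<close> of
  \<open>n - p\<close> coordinates. Accordingly the matrix \<open>Z\<close> has its \<open>n - p\<close> columns at the positions in \<open>I\<close>
  and is padded with zero columns. Products, transposes, inner products and norms agree with those
  of the unpadded objects.
\<close>

definition null_basis :: "'n set \<Rightarrow> real ^ 'n ^ 'p \<Rightarrow> real ^ 'n ^ ('n::finite) \<Rightarrow> bool" where
  "null_basis I A Z \<longleftrightarrow>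
     (\<forall>i\<in>I. \<forall>j\<in>I. column i Z \<bullet> column j Z = (if i = j then 1 else 0))
     \<and> span ((\<lambda>i. column i Z) ` I) = {y. A *v y = 0}
     \<and> (\<forall>i. i \<notin> I \<longrightarrow> column i Z = 0)"

definition pos_def_on :: "'n set \<Rightarrow> real ^ 'n ^ ('n::finite) \<Rightarrow> bool" where
  "pos_def_on I A \<longleftrightarrow> (\<forall>w. w \<noteq> 0 \<and> (\<forall>i. i \<notin> I \<longrightarrow> w $ i = 0) \<longrightarrow> w \<bullet> (A *v w) > 0)"

record ssarc_params =
  eta1 :: real
  eta2 :: real
  gamma1 :: real
  gamma2 :: real
  nu :: real
  tau1 :: real
  tau2 :: real
  theta :: real
  xi :: real
  zeta :: real
  eL :: nat
  eU :: nat

definition valid_params :: "ssarc_params \<Rightarrow> bool" where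
  "valid_params P \<longleftrightarrow>
     0 < eta1 P \<and> eta1 P < eta2 P \<and> eta2 P < 1 \<and>
     0 < gamma1 P \<and> gamma1 P < 1 \<and> 1 < gamma2 P \<and>
     0 < nu P \<and> nu P < 1 \<and> 1 < tau1 P \<and> 0 < tau2 P \<and>
     0 < theta P \<and> theta P \<le> 1 \<and> 0 < xi P \<and> 0 < zeta P \<and> zeta P \<le> 1 \<and>
     0 < eL P \<and> 0 < eU P"

primrec shift :: "ssarc_params \<Rightarrow> nat \<Rightarrow> real" where
  "shift P 0 = 10 powr (- real (eL P) / 2)"
| "shift P (Suc i) = 10 powr (1/2) * shift P i"

abbreviation max_shift :: "ssarc_params \<Rightarrow> nat" where
  "max_shift P \<equiv> eL P + eU P"


section \<open>Runs of the algorithm\<close>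

text \<open>
  Sequences are indexed by the outer iteration \<open>k\<close> and, where they change in the inner loop, also by
  the number \<open>l\<close> of trials rejected so far in it; the trial number \<open>N k\<close> is the accepted one.
  Thus \<open>js k l\<close> is the index \<open>j\<close> of the shift used by trial \<open>l\<close> and \<open>\<beta> k l\<close> is the value of
  \<open>\<beta>\<^sub>k\<close> at trial \<open>l\<close>. The sequence \<open>\<mu>\<close> is moved by one place: \<open>\<mu> k\<close> is the penalty parameter with
  index \<open>k - 1\<close>, so that \<open>\<mu> 0\<close> is its initial value.

  A rejection computes a reduced value of \<open>\<beta>\<close>. The flag \<open>carry\<close> tells what becomes of it: if it is
  false, \<open>\<beta>\<^sub>k\<close> is constant within outer iteration \<open>k\<close> and the reduced value only serves to select the
  next shift; if it is true, the reduced value replaces \<open>\<beta>\<^sub>k\<close> for the remaining trials and for the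
  update after acceptance.
\<close>

locale ssarc_sequences =
  fixes P :: ssarc_params
    and f :: "real ^ 'n \<Rightarrow> real"
    and g :: "real ^ 'n \<Rightarrow> real ^ 'n"
    and c :: "real ^ 'n \<Rightarrow> real ^ 'p"
    and J :: "real ^ 'n \<Rightarrow> real ^ 'n ^ 'p"
    and I :: "('n::finite) set"
    and carry :: bool
    and x :: "nat \<Rightarrow> real ^ 'n"
    and B :: "nat \<Rightarrow> real ^ 'n ^ 'n"
    and Z :: "nat \<Rightarrow> real ^ 'n ^ 'n"
    and \<alpha> :: "nat \<Rightarrow> real"
    and \<beta> :: "nat \<Rightarrow> nat \<Rightarrow> real"
    and \<mu> :: "nat \<Rightarrow> real"
    and js :: "nat \<Rightarrow> nat \<Rightarrow> nat"
    and N :: "nat \<Rightarrow> nat"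
begin

definition v :: "nat \<Rightarrow> real ^ 'n" where
  "v k = \<alpha> k *\<^sub>R vertical_dir c J (x k)"

definition gZ :: "nat \<Rightarrow> real ^ 'n" where
  "gZ k = transpose (Z k) *v (g (x k) + B k *v v k)"

definition BZ :: "nat \<Rightarrow> real ^ 'n ^ 'n" where
  "BZ k = transpose (Z k) ** B k ** Z k"

definition u :: "nat \<Rightarrow> nat \<Rightarrow> real ^ 'n" where
  "u k i = cg_lanczos (xi P) (zeta P) (BZ k) (gZ k) (shift P i)"

definition iplus :: "nat \<Rightarrow> nat" where
  "iplus k = (LEAST i. pos_def_on I (BZ k + mat (shift P i)))"

definition h :: "nat \<Rightarrow> nat \<Rightarrow> real ^ 'n" where
  "h k l = Z k *v u k (js k l)"

definition d :: "nat \<Rightarrow> nat \<Rightarrow> real ^ 'n" where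
  "d k l = v k + h k l"

definition DqN :: "nat \<Rightarrow> real" where
  "DqN k = norm (c (x k)) - norm (c (x k) + J (x k) *v v k)"

definition DqH :: "nat \<Rightarrow> nat \<Rightarrow> real" where
  "DqH k l = - ((g (x k) + B k *v v k) \<bullet> h k l) - 1/2 * (h k l \<bullet> (B k *v h k l))"

definition DqF :: "nat \<Rightarrow> real" where
  "DqF k = - (g (x k) \<bullet> v k) - 1/2 * (v k \<bullet> (B k *v v k))"

definition mu_c :: "nat \<Rightarrow> nat \<Rightarrow> real" where
  "mu_c k l = - ((DqF k + DqH k l) / ((1 - nu P) * DqN k))"

definition mu_trial :: "nat \<Rightarrow> nat \<Rightarrow> real" where
  "mu_trial k l =
     (if DqN k \<noteq> 0 \<and> \<mu> k < mu_c k l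
      then max (mu_c k l) (max (tau1 P * \<mu> k) (\<mu> k + tau2 P))
      else \<mu> k)"

definition Dq :: "nat \<Rightarrow> nat \<Rightarrow> real" where
  "Dq k l = qmodel f g c J (x k) (B k) (mu_trial k l) 0
          - qmodel f g c J (x k) (B k) (mu_trial k l) (d k l)"

definition rho :: "nat \<Rightarrow> nat \<Rightarrow> real" where
  "rho k l = (merit f c (x k) (mu_trial k l) - merit f c (x k + d k l) (mu_trial k l)) / Dq k l"

definition beta_reduced :: "nat \<Rightarrow> nat \<Rightarrow> real" where
  "beta_reduced k i = norm (u k i) / shift P i"

end

locale ssarc_run = ssarc_sequences P f g c J I carry x B Z \<alpha> \<beta> \<mu> js N
  for P :: ssarc_params
    and f :: "real ^ 'n \<Rightarrow> real"
    and g :: "real ^ 'n \<Rightarrow> real ^ 'n"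
    and c :: "real ^ 'n \<Rightarrow> real ^ 'p"
    and J :: "real ^ 'n \<Rightarrow> real ^ 'n ^ 'p"
    and I :: "('n::finite) set"
    and carry x B Z \<alpha> \<beta> \<mu> js N +
  assumes params: "valid_params P"
    and beta_init: "\<beta> 0 0 > 0"
    and mu_init: "\<mu> 0 > 0"
    and not_kkt: "\<not> kkt_point g c J (x k)"
    and B_sym: "transpose (B k) = B k"
    and card_I: "card I = CARD('n) - CARD('p)"
    and Z_basis: "null_basis I (J (x k)) (Z k)"
    \<comment> \<open>No condition for a zero vertical direction, where the quotients are infinite and \<open>v k = 0\<close>.\<close>
    and vertical: "vertical_dir c J (x k) \<noteq> 0 \<Longrightarrow>
      \<alpha> k \<in> {min 1 (theta P * sqrt (\<beta> k 0) / norm (vertical_dir c J (x k))) ..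
              min 1 (sqrt (\<beta> k 0) / norm (vertical_dir c J (x k)))}"
    and iplus_exists: "\<exists>i\<le>max_shift P. pos_def_on I (BZ k + mat (shift P i))"
    and first_shift: "is_arg_min (\<lambda>i. \<bar>\<beta> k 0 * shift P i - norm (u k i)\<bar>)
      (\<lambda>i. iplus k \<le> i \<and> i \<le> max_shift P) (js k 0)"
    and rejected: "l < N k \<Longrightarrow> rho k l < eta1 P"
    \<comment> \<open>The search ends at the first larger index whose reduced value does not exceed \<open>\<gamma>\<^sub>1 \<beta>\<^sub>k\<close>.\<close>
    and next_shift: "l < N k \<Longrightarrow>
      js k l < js k (Suc l) \<and> js k (Suc l) \<le> max_shift P
      \<and> beta_reduced k (js k (Suc l)) \<le> gamma1 P * \<beta> k l
      \<and> (\<forall>i. js k l < i \<and> i < js k (Suc l) \<longrightarrow> beta_reduced k i > gamma1 P * \<beta> k l)"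
    and beta_inner: "l < N k \<Longrightarrow>
      \<beta> k (Suc l) = (if carry then beta_reduced k (js k (Suc l)) else \<beta> k l)"
    and accepted: "rho k (N k) \<ge> eta1 P"
    and mu_next: "\<mu> (Suc k) = mu_trial k (N k)"
    and x_next: "x (Suc k) = x k + d k (N k)"
    and beta_next: "\<beta> (Suc k) 0 =
      (if rho k (N k) > eta2 P then gamma2 P * \<beta> k (N k) else \<beta> k (N k))"
begin

definition lambda :: "nat \<Rightarrow> real" where
  "lambda k = shift P (js k (N k))"

definition u_acc :: "nat \<Rightarrow> real ^ 'n" where
  "u_acc k = u k (js k (N k))"

definition beta_acc :: "nat \<Rightarrow> real" where
  "beta_acc k = \<beta> k (N k)"

end

locale ssarc_standing = ssarc_run P f g c J I carry x B Z \<alpha> \<beta> \<mu> js N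
  for P :: ssarc_params
    and f :: "real ^ 'n \<Rightarrow> real"
    and g :: "real ^ 'n \<Rightarrow> real ^ 'n"
    and c :: "real ^ 'n \<Rightarrow> real ^ 'p"
    and J :: "real ^ 'n \<Rightarrow> real ^ 'n ^ 'p"
    and I :: "('n::finite) set"
    and carry x B Z \<alpha> \<beta> \<mu> js N +
  fixes t \<beta>max :: real
  assumes t_ge: "t \<ge> 1"
    and beta_max_pos: "\<beta>max > 0"
    and beta_bounded: "\<beta> k 0 \<le> \<beta>max"
    and full_row_rank: "rank (J (x k)) = CARD('p)"
    and curvature: "u_acc k \<bullet> ((BZ k + mat (lambda k)) *v u_acc k) \<ge> 0"
    and shift_lower: "1 / t * (norm (u_acc k) / beta_acc k) \<le> lambda k"
    and shift_upper: "lambda k \<le> t * (norm (u_acc k) / beta_acc k)"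
    and residual: "norm (gZ k + (BZ k + mat (lambda k)) *v u_acc k)
      \<le> xi P * min (norm (gZ k)) (norm (u_acc k)) powr (1 + zeta P)"

end

theory Submission
  imports Defs
begin

text \<open>
  The Galerkin property of CG (the residual is orthogonal to the iterate) gives
  \<open>\<Delta>q\<^sup>H \<ge> \<lambda> \<parallel>u\<parallel>\<^sup>2 / 2\<close>. By the bound on the vertical direction,
  \<open>\<parallel>v\<parallel> \<le> \<kappa> \<Delta>q\<^sup>N\<close>, hence \<open>\<bar>\<Delta>q\<^sup>F\<bar>\<close> is at most a constant times \<open>\<Delta>q\<^sup>N\<close>. So \<open>\<mu>\<^sup>c\<close> is bounded,
  and as every increase of the penalty parameter is at least \<open>\<tau>\<^sub>2\<close>, it is eventually constant. From then on
  the merit function decreases by at least \<open>\<eta>\<^sub>1 \<Delta>q\<close> and is bounded below, so \<open>\<Delta>q \<rightarrow> 0\<close>. This forces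
  \<open>\<Delta>q\<^sup>N\<close>, \<open>v\<close>, \<open>\<Delta>q\<^sup>F\<close>, \<open>\<Delta>q\<^sup>H\<close> to \<open>0\<close>, and also \<open>u\<close>, because the finitely many shifts are bounded away
  from \<open>0\<close>. They are also bounded above, so the residual bound yields \<open>g\<^sup>Z \<rightarrow> 0\<close>.
\<close>

section \<open>Residuals of CG-Lanczos\<close>

lemma inner_transpose_mult:
  fixes A :: "real ^ 'n ^ 'm"
  shows "(transpose A *v y) \<bullet> z = y \<bullet> (A *v z)"
  by (simp add: dot_lmul_matrix)

lemma inner_symmetric_mult:
  fixes A :: "real ^ 'n ^ 'n"
  assumes "transpose A = A"
  shows "(A *v y) \<bullet> z = y \<bullet> (A *v z)"
  using inner_transpose_mult[of A y z] assms by simp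

lemma mat_add_mult:
  fixes A :: "real ^ 'n ^ 'n"
  shows "(A + mat lam) *v w = A *v w + lam *\<^sub>R w"
proof -
  have "mat lam *v w = lam *\<^sub>R w"
    by (simp add: vec_eq_iff matrix_vector_mult_def mat_def if_distrib if_distribR cong: if_cong)
  then show ?thesis
    by (simp add: matrix_vector_mult_add_rdistrib)
qed

text \<open>By symmetry \<open>T\<close> can be moved from \<open>y l\<close> to \<open>y i\<close>,
  and \<open>T (y i)\<close> is a combination of three neighbouring vectors, so at most the one with
  index \<open>Suc i\<close> meets \<open>y l\<close>. The second case of \<open>unit\<close> admits
  breakdown, where vector and coefficient vanish together.\<close>

lemma lanczos_orthogonal:
  fixes y e :: "nat \<Rightarrow> 'a::real_inner" and a :: "nat \<Rightarrow> real"
  assumes sym: "\<And>p q. T p \<bullet> q = p \<bullet> T q" and T0: "T 0 = 0"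
    and e0: "e 0 = 0" and eS: "\<And>l. e (Suc l) = y l"
    and rec: "\<And>l. a (Suc l) *\<^sub>R y (Suc l) = T (y l) - (y l \<bullet> T (y l)) *\<^sub>R y l - a l *\<^sub>R e l"
    and unit: "\<And>l. norm (y l) = 1 \<and> a l \<noteq> 0 \<or> y l = 0 \<and> a l = 0"
  shows "i < j \<Longrightarrow> y i \<bullet> y j = 0"
proof (induction j arbitrary: i rule: less_induct)
  case (less j)
  then obtain l where j: "j = Suc l" using not0_implies_Suc by fastforce
  have IH: "y i \<bullet> y m = 0" if "i < m" "m \<le> l" for i m
    using less.IH that j by simp
  have sq: "y m \<bullet> y m = 1 \<and> a m \<noteq> 0 \<or> y m = 0 \<and> a m = 0" for m
    using unit[of m] by (auto simp: dot_square_norm)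
  have e_l: "y l \<bullet> e l = 0"
    using IH by (cases l) (simp_all add: e0 eS inner_commute)
  have "y i \<bullet> (T (y l) - (y l \<bullet> T (y l)) *\<^sub>R y l - a l *\<^sub>R e l) = 0"
  proof (cases "i = l")
    case True
    then show ?thesis
      using sq[of l] e_l by (auto simp: inner_diff_right T0)
  next
    case False
    then have il: "i < l" using less.prems j by simp
    then obtain l' where l': "l = Suc l'" using not0_implies_Suc by fastforce
    have ei: "e i \<bullet> y l = 0"
      using IH il by (cases i) (simp_all add: e0 eS)
    have "y i \<bullet> T (y l) = T (y i) \<bullet> y l" by (simp add: sym)
    also have "T (y i) = a (Suc i) *\<^sub>R y (Suc i) + (y i \<bullet> T (y i)) *\<^sub>R y i + a i *\<^sub>R e i"
      by (simp add: rec)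
    also have "\<dots> \<bullet> y l = a (Suc i) * (y (Suc i) \<bullet> y l)"
      using IH il ei by (simp add: inner_add_left)
    finally have T1: "y i \<bullet> T (y l) = a (Suc i) * (y (Suc i) \<bullet> y l)" .
    \<comment> \<open>For \<open>Suc i = l\<close> both inner products are squared norms, of
      \<open>y l\<close> and of \<open>y i\<close>; otherwise both sides vanish.\<close>
    have "a (Suc i) * (y (Suc i) \<bullet> y l) = a l * (y i \<bullet> e l)"
    proof (cases "Suc i = l")
      case True
      \<comment> \<open>A breakdown at \<open>i\<close> persists: the recurrence then reads
        \<open>a l *\<^sub>R y l = 0\<close>.\<close>
      have "a l = 0" if "y i = 0"
      proof -
        have "a l *\<^sub>R y l = 0"
          using rec[of i] True that sq[of i] by (simp add: T0)
        then show ?thesis using sq[of l] by auto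
      qed
      then show ?thesis
        using True sq[of l] sq[of i] eS[of i] by auto
    next
      case False
      then have "y (Suc i) \<bullet> y l = 0" "y i \<bullet> e l = 0"
        using il IH l' eS[of l'] by auto
      then show ?thesis by simp
    qed
    then show ?thesis using T1 IH il by (simp add: inner_diff_right)
  qed
  then have "a j * (y i \<bullet> y j) = 0"
    using rec[of l] j by (metis inner_scaleR_right)
  moreover have "a j = 0 \<Longrightarrow> y j = 0"
    using unit[of j] by auto
  ultimately show ?case by auto
qed


text \<open>The next Lanczos vector before normalization, called \<open>z\<close> inside
  \<open>cgl_step\<close>.\<close>

definition cgl_vec :: "real ^ 'n ^ 'n \<Rightarrow> ('n::finite) cgl_state \<Rightarrow> real ^ 'n" where
  "cgl_vec B s = B *v ups s - (ups s \<bullet> (B *v ups s)) *\<^sub>R ups s - lan s *\<^sub>R ups_prev s"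

lemma cgl_step_simps:
  "ups_prev (cgl_step B lam s) = ups s"
  "lan (cgl_step B lam s) = norm (cgl_vec B s)"
  "ups (cgl_step B lam s) = cgl_vec B s /\<^sub>R norm (cgl_vec B s)"
  "omg_prev (cgl_step B lam s) = (norm (cgl_vec B s) * cgl_piv B lam s)\<^sup>2"
  "piv_prev (cgl_step B lam s) = cgl_piv B lam s"
  "cgs (cgl_step B lam s) = - norm (cgl_vec B s) * cgl_piv B lam s * cgs s"
  "wvec (cgl_step B lam s) = wvec s + cgl_piv B lam s *\<^sub>R pvec s"
  "pvec (cgl_step B lam s) =
     (- norm (cgl_vec B s) * cgl_piv B lam s * cgs s) *\<^sub>R (cgl_vec B s /\<^sub>R norm (cgl_vec B s))
     + (norm (cgl_vec B s) * cgl_piv B lam s)\<^sup>2 *\<^sub>R pvec s"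
  by (simp_all add: cgl_step_def cgl_vec_def Let_def)

lemma cgl_iter_Suc: "cgl_iter B b lam (Suc l) = cgl_step B lam (cgl_iter B b lam l)"
  by (simp add: cgl_iter_def)

lemma cgl_iter_0: "cgl_iter B b lam 0 = cgl_init b"
  by (simp add: cgl_iter_def)

text \<open>For \<open>b = 0\<close> or a vanishing \<open>cgl_vec\<close>, scaling by the inverse
  of 0 gives the zero vector, which is the breakdown case of
  \<open>lanczos_orthogonal\<close>.\<close>

lemma cgl_orthogonal:
  assumes sym: "transpose B = B" and "i < j"
  shows "ups (cgl_iter B b lam i) \<bullet> ups (cgl_iter B b lam j) = 0"
proof (rule lanczos_orthogonal[where T = "(*v) B" and a = "\<lambda>l. lan (cgl_iter B b lam l)"
      and e = "\<lambda>l. ups_prev (cgl_iter B b lam l)"])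
  fix l
  show "lan (cgl_iter B b lam (Suc l)) *\<^sub>R ups (cgl_iter B b lam (Suc l)) =
      B *v ups (cgl_iter B b lam l)
      - (ups (cgl_iter B b lam l) \<bullet> (B *v ups (cgl_iter B b lam l))) *\<^sub>R ups (cgl_iter B b lam l)
      - lan (cgl_iter B b lam l) *\<^sub>R ups_prev (cgl_iter B b lam l)"
    by (cases "cgl_vec B (cgl_iter B b lam l) = 0")
      (simp_all add: cgl_iter_Suc cgl_step_simps flip: cgl_vec_def)
  show "norm (ups (cgl_iter B b lam l)) = 1 \<and> lan (cgl_iter B b lam l) \<noteq> 0
      \<or> ups (cgl_iter B b lam l) = 0 \<and> lan (cgl_iter B b lam l) = 0"
    by (cases l) (auto simp: cgl_iter_Suc cgl_step_simps cgl_iter_0 cgl_init_def)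
qed (use assms in \<open>auto simp: inner_symmetric_mult cgl_iter_Suc cgl_step_simps cgl_iter_0 cgl_init_def\<close>)

text \<open>The pivot is the step length that cancels the old Lanczos vector in the residual. The
  choice of \<open>omg_prev\<close> turns the old vector in the image of the direction into the last
  term of the three-term recurrence; what remains along the new vector gives the next pivot.\<close>

lemma cgl_recurrence_step:
  assumes res: "b + (B + mat lam) *v wvec s = - cgs s *\<^sub>R ups s"
    and dir: "(B + mat lam) *v pvec s = cgs s *\<^sub>R (cgl_vec B s + (1 / cgl_piv B lam s) *\<^sub>R ups s)"
    and piv: "cgl_piv B lam s \<noteq> 0" and s': "s' = cgl_step B lam s"
  shows "b + (B + mat lam) *v wvec s' = - cgs s' *\<^sub>R ups s'"
    and "(B + mat lam) *v pvec s' = cgs s' *\<^sub>R (cgl_vec B s' + (1 / cgl_piv B lam s') *\<^sub>R ups s')"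
proof -
  define a where "a = norm (cgl_vec B s)"
  define q where "q = cgl_piv B lam s"
  have z: "cgl_vec B s = a *\<^sub>R ups s'"
    by (cases "cgl_vec B s = 0") (simp_all add: s' cgl_step_simps a_def)
  have q: "q \<noteq> 0" using piv by (simp add: q_def)
  have cgs': "cgs s' = - a * q * cgs s" and p': "pvec s' = cgs s' *\<^sub>R ups s' + (a * q)\<^sup>2 *\<^sub>R pvec s"
    and w': "wvec s' = wvec s + q *\<^sub>R pvec s" and prev: "ups_prev s' = ups s" "lan s' = a"
      "omg_prev s' = (a * q)\<^sup>2" "piv_prev s' = q"
    by (simp_all add: s' cgl_step_simps a_def q_def)
  have dir': "(B + mat lam) *v pvec s = cgs s *\<^sub>R (a *\<^sub>R ups s' + (1 / q) *\<^sub>R ups s)"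
    using dir by (simp add: z q_def)
  have "b + (B + mat lam) *v wvec s' = (b + (B + mat lam) *v wvec s) + q *\<^sub>R ((B + mat lam) *v pvec s)"
    unfolding w' by (simp add: matrix_vector_right_distrib matrix_vector_mult_scaleR)
  also have "\<dots> = - cgs s' *\<^sub>R ups s'"
    using q unfolding res dir' cgs' by (simp add: scaleR_add_right)
  finally show "b + (B + mat lam) *v wvec s' = - cgs s' *\<^sub>R ups s'" .
  have den: "1 / cgl_piv B lam s' = ups s' \<bullet> (B *v ups s') + lam - a\<^sup>2 * q"
    using q by (simp add: cgl_piv_def prev power2_eq_square)
  have "(B + mat lam) *v pvec s' = cgs s' *\<^sub>R ((B + mat lam) *v ups s') + (a * q)\<^sup>2 *\<^sub>R ((B + mat lam) *v pvec s)"
    unfolding p' by (simp add: matrix_vector_right_distrib matrix_vector_mult_scaleR)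
  also have "\<dots> = cgs s' *\<^sub>R (B *v ups s' + lam *\<^sub>R ups s')
      + (a * q)\<^sup>2 *\<^sub>R (cgs s *\<^sub>R (a *\<^sub>R ups s' + (1 / q) *\<^sub>R ups s))"
    unfolding dir' unfolding mat_add_mult by simp
  also have "\<dots> = cgs s' *\<^sub>R (cgl_vec B s' + (1 / cgl_piv B lam s') *\<^sub>R ups s')"
    unfolding den cgl_vec_def prev cgs' using q
    by (simp add: algebra_simps power2_eq_square)
  finally show "(B + mat lam) *v pvec s' = cgs s' *\<^sub>R (cgl_vec B s' + (1 / cgl_piv B lam s') *\<^sub>R ups s')" .
qed

lemma cgl_residual:
  assumes "\<And>m. m < l \<Longrightarrow> cgl_piv B lam (cgl_iter B b lam m) \<noteq> 0"
  shows "b + (B + mat lam) *v wvec (cgl_iter B b lam l)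
      = - cgs (cgl_iter B b lam l) *\<^sub>R ups (cgl_iter B b lam l)"
proof -
  \<comment> \<open>The image of the search direction is carried through the induction because the
    residual update needs it.\<close>
  have "b + (B + mat lam) *v wvec (cgl_iter B b lam l)
      = - cgs (cgl_iter B b lam l) *\<^sub>R ups (cgl_iter B b lam l) \<and>
    (B + mat lam) *v pvec (cgl_iter B b lam l) = cgs (cgl_iter B b lam l) *\<^sub>R
      (cgl_vec B (cgl_iter B b lam l)
       + (1 / cgl_piv B lam (cgl_iter B b lam l)) *\<^sub>R ups (cgl_iter B b lam l))"
    using assms
  proof (induction l)
    case 0
    have "(B + mat lam) *v (norm b *\<^sub>R ups (cgl_init b)) = norm b *\<^sub>R
      (cgl_vec B (cgl_init b) + (1 / cgl_piv B lam (cgl_init b)) *\<^sub>R ups (cgl_init b))"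
      unfolding matrix_vector_mult_scaleR mat_add_mult
      by (simp add: cgl_vec_def cgl_piv_def cgl_init_def algebra_simps)
    then show ?case
      by (cases "b = 0") (simp_all add: cgl_iter_0 cgl_init_def)
  next
    case (Suc l)
    then show ?case
      using cgl_recurrence_step[of b B lam "cgl_iter B b lam l"] by (simp add: cgl_iter_Suc)
  qed
  then show ?thesis by blast
qed

text \<open>The two memberships are proved together: the direction reaches one Lanczos vector
  further than the iterate and is added to it in the next step.\<close>

lemma cgl_iterate_in_span:
  "wvec (cgl_iter B b lam l) \<in> span ((\<lambda>m. ups (cgl_iter B b lam m)) ` {..<l})
   \<and> pvec (cgl_iter B b lam l) \<in> span ((\<lambda>m. ups (cgl_iter B b lam m)) ` {..l})"
proof (induction l)
  case 0
  have "- b = norm b *\<^sub>R ups (cgl_init b)" by (cases "b = 0") (simp_all add: cgl_init_def)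
  then have "- b \<in> span {ups (cgl_init b)}"
    by (metis insertI1 span_base span_scale)
  then show ?case by (simp add: cgl_iter_0) (simp add: cgl_init_def span_zero)
next
  case (Suc l)
  let ?y = "\<lambda>m. ups (cgl_iter B b lam m)" and ?s = "cgl_iter B b lam l"
  have sub: "span (?y ` {..<l}) \<subseteq> span (?y ` {..<Suc l})" "span (?y ` {..l}) \<subseteq> span (?y ` {..Suc l})"
    by (intro span_mono image_mono; auto)+
  have "?y (Suc l) \<in> span (?y ` {..Suc l})"
    by (intro span_base) auto
  moreover have "pvec (cgl_iter B b lam (Suc l)) = cgs (cgl_iter B b lam (Suc l)) *\<^sub>R ?y (Suc l)
      + omg_prev (cgl_iter B b lam (Suc l)) *\<^sub>R pvec ?s"
    by (simp only: cgl_iter_Suc cgl_step_simps)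
  moreover have "wvec (cgl_iter B b lam (Suc l)) = wvec ?s + cgl_piv B lam ?s *\<^sub>R pvec ?s"
    by (simp only: cgl_iter_Suc cgl_step_simps)
  ultimately show ?case
    using Suc.IH sub by (auto simp: lessThan_Suc_atMost intro!: span_add span_scale)
qed

text \<open>Galerkin property: the residual is a multiple of the Lanczos vector \<open>\<upsilon>\<^sub>l\<close>, which is orthogonal
  to the Krylov space containing the iterate \<open>w\<^sub>l\<close>.\<close>

lemma cg_lanczos_residual_orthogonal:
  fixes B :: "real ^ 'n ^ ('n::finite)" and xi zeta :: real
  assumes sym: "transpose B = B"
  shows "(b + (B + mat lam) *v cg_lanczos xi zeta B b lam) \<bullet> cg_lanczos xi zeta B b lam = 0"
proof -
  define l where "l = (LEAST l. cgl_stop xi zeta B b lam (cgl_iter B b lam l))"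
  \<comment> \<open>This holds by the nature of \<open>LEAST\<close>, attained or not, and makes all
    earlier pivots positive.\<close>
  have "\<not> cgl_stop xi zeta B b lam (cgl_iter B b lam m)" if "m < l" for m
    using not_less_Least that unfolding l_def by blast
  then have "cgl_piv B lam (cgl_iter B b lam m) \<noteq> 0" if "m < l" for m
    using that unfolding cgl_stop_def by (metis order_refl)
  then have res: "b + (B + mat lam) *v wvec (cgl_iter B b lam l)
      = - cgs (cgl_iter B b lam l) *\<^sub>R ups (cgl_iter B b lam l)"
    by (rule cgl_residual)
  have "orthogonal (ups (cgl_iter B b lam l)) (wvec (cgl_iter B b lam l))"
  proof (rule orthogonal_to_span)
    show "wvec (cgl_iter B b lam l) \<in> span ((\<lambda>m. ups (cgl_iter B b lam m)) ` {..<l})"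
      using cgl_iterate_in_span by blast
  qed (auto simp: orthogonal_def inner_commute cgl_orthogonal[OF sym])
  then show ?thesis
    using res by (simp add: cg_lanczos_def orthogonal_def flip: l_def)
qed


section \<open>Null-space bases and vertical directions\<close>

lemma norm_mult_le_entries:
  fixes A :: "real ^ 'n ^ ('m::finite)"
  assumes "\<And>i. norm (A $ i) \<le> C"
  shows "norm (A *v y) \<le> real CARD('m) * C * norm y"
proof -
  have "norm (A *v y) \<le> (\<Sum>i\<in>UNIV. \<bar>(A *v y) $ i\<bar>)" by (rule norm_le_l1_cart)
  also have "\<dots> \<le> (\<Sum>i\<in>(UNIV::'m set). C * norm y)"
  proof (rule sum_mono)
    fix i
    have "\<bar>(A *v y) $ i\<bar> \<le> norm (A $ i) * norm y"
      by (simp add: matrix_vector_mul_component Cauchy_Schwarz_ineq2)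
    also have "\<dots> \<le> C * norm y" using assms by (intro mult_right_mono) auto
    finally show "\<bar>(A *v y) $ i\<bar> \<le> C * norm y" .
  qed
  finally show ?thesis by simp
qed

text \<open>Every column of \<open>Z\<close> is a unit vector of the null space or zero padding. The
  crude factor \<open>CARD('n)\<close> suffices, since the bounds only serve to pass to
  limits.\<close>

lemma null_basis_props:
  fixes A :: "real ^ 'n ^ 'p" and Z :: "real ^ 'n ^ ('n::finite)"
  assumes "null_basis I A Z"
  shows "A *v (Z *v w) = 0"
    and "norm (transpose Z *v y) \<le> real CARD('n) * norm y"
    and "norm (Z *v y) \<le> real CARD('n) * norm y"
proof -
  have Z: "\<And>i j. i \<in> I \<Longrightarrow> j \<in> I \<Longrightarrow> column i Z \<bullet> column j Z = (if i = j then 1 else 0)"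
    "span ((\<lambda>i. column i Z) ` I) = {y. A *v y = 0}" "\<And>i. i \<notin> I \<Longrightarrow> column i Z = 0"
    using assms unfolding null_basis_def by auto
  have "A *v column i Z = 0" for i
  proof (cases "i \<in> I")
    case True
    then have "column i Z \<in> span ((\<lambda>i. column i Z) ` I)" by (intro span_base) auto
    then show ?thesis using Z(2) by auto
  qed (simp add: Z)
  moreover have "A *v (Z *v w) = (\<Sum>i\<in>UNIV. w $ i *\<^sub>R (A *v column i Z))"
    unfolding matrix_mult_sum[of Z] scalar_mult_eq_scaleR
    by (simp add: linear_sum[OF matrix_vector_mul_linear] matrix_vector_mult_scaleR)
  ultimately show "A *v (Z *v w) = 0" by simp
  have col: "norm (column i Z) \<le> 1" for i
    using Z(1)[of i i] Z(3)[of i] by (cases "i \<in> I") (auto simp: norm_eq_sqrt_inner)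
  show "norm (transpose Z *v y) \<le> real CARD('n) * norm y"
    using norm_mult_le_entries[of "transpose Z" 1 y] col
    by (simp add: column_def transpose_def del: transpose_matrix_vector)
  have "norm (Z *v y) \<le> (\<Sum>i\<in>UNIV. norm (y $ i *\<^sub>R column i Z))"
    unfolding matrix_mult_sum[of Z] scalar_mult_eq_scaleR by (rule norm_sum)
  also have "\<dots> \<le> (\<Sum>i\<in>(UNIV :: 'n set). norm y)"
  proof (rule sum_mono)
    fix i
    have "norm (y $ i *\<^sub>R column i Z) \<le> \<bar>y $ i\<bar> * 1"
      using col[of i] by (simp add: mult_left_le)
    also have "\<dots> \<le> norm y" by (simp add: component_le_norm_cart)
    finally show "norm (y $ i *\<^sub>R column i Z) \<le> norm y" .
  qed
  finally show "norm (Z *v y) \<le> real CARD('n) * norm y" by simp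
qed

text \<open>The Gram matrix of the rows is invertible: if it annihilates \<open>w\<close>, then
  \<open>transpose (J y) *v w\<close> has norm 0, and the transpose is injective by full row
  rank.\<close>

lemma full_row_rank_vertical_dir:
  fixes J :: "real ^ 'n \<Rightarrow> real ^ 'n ^ ('p::finite)"
  assumes "rank (J y) = CARD('p)"
  shows "J y *v vertical_dir c J y = - c y"
proof -
  let ?A = "J y"
  have inj: "inj ((*v) (transpose ?A))"
    using assms full_rank_injective[of "transpose ?A"] by (simp add: rank_transpose)
  have "w = 0" if "(?A ** transpose ?A) *v w = 0" for w
  proof -
    have "?A *v (transpose ?A *v w) = 0"
      using that by (simp only: matrix_vector_mul_assoc)
    then have "(transpose ?A *v w) \<bullet> (transpose ?A *v w) = 0"
      by (subst inner_transpose_mult) (simp del: transpose_matrix_vector)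
    then have "transpose ?A *v w = transpose ?A *v 0" by simp
    then show "w = 0" by (rule injD[OF inj])
  qed
  then have "invertible (?A ** transpose ?A)"
    unfolding invertible_left_inverse matrix_left_invertible_ker by blast
  then have "(?A ** transpose ?A) ** matrix_inv (?A ** transpose ?A) = mat 1"
    by (simp add: matrix_inv_def invertible_def) (metis (mono_tags, lifting) someI_ex)
  then have "?A *v (transpose ?A *v (matrix_inv (?A ** transpose ?A) *v c y)) = c y"
    by (simp add: matrix_vector_mul_assoc matrix_mul_assoc del: transpose_matrix_vector)
  then show ?thesis
    unfolding vertical_dir_def by (simp add: linear_neg[OF matrix_vector_mul_linear] del: transpose_matrix_vector)
qed

section \<open>Model and merit decrease\<close>

lemma shift_pos: "shift P i > 0"
  by (induction i) auto

lemma shift_mono: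
  assumes "i \<le> j"
  shows "shift P i \<le> shift P j"
proof (rule lift_Suc_mono_le[OF _ assms])
  fix n
  have "1 * shift P n \<le> 10 powr (1/2) * shift P n"
    using shift_pos[of P n] by (intro mult_right_mono) (auto simp: ge_one_powr_ge_zero)
  then show "shift P n \<le> shift P (Suc n)" by simp
qed

context ssarc_standing
begin

section \<open>Reduced Hessian, accepted shifts and the parameters \<beta>\<close>

lemma BZ_inner: "w \<bullet> (BZ k *v y) = (Z k *v w) \<bullet> (B k *v (Z k *v y))"
  unfolding BZ_def matrix_vector_mul_assoc[symmetric]
  using inner_transpose_mult[of "Z k" "B k *v (Z k *v y)" w] by (metis inner_commute)

lemma BZ_sym: "transpose (BZ k) = BZ k"
  unfolding BZ_def by (simp add: matrix_transpose_mul B_sym matrix_mul_assoc)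

text \<open>All trials take their shifts from one finite grid, so these bounds are uniform in
  \<open>k\<close>.\<close>

lemma lambda_bounds: "shift P 0 \<le> lambda k" "lambda k \<le> shift P (max_shift P)"
proof -
  have "js k (N k) \<le> max_shift P"
  proof (cases "N k")
    case 0
    then show ?thesis using first_shift[of k] by (simp add: is_arg_min_def)
  next
    case (Suc l)
    then show ?thesis using next_shift[of l k] by simp
  qed
  then show "lambda k \<le> shift P (max_shift P)"
    unfolding lambda_def by (rule shift_mono)
  show "shift P 0 \<le> lambda k"
    unfolding lambda_def by (rule shift_mono[OF le0])
qed

text \<open>A positive shift lies below \<open>t\<close> times the quotient by
  \<open>beta_acc k\<close>, which excludes negative values, and also 0, where the quotient is 0 by
  convention.\<close>

lemma beta_acc_pos: "beta_acc k > 0"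
proof -
  have pos: "0 < t * (norm (u_acc k) / beta_acc k)"
    using shift_upper[of k] shift_pos[of P] unfolding lambda_def by (meson less_le_trans)
  have "t * (norm (u_acc k) / beta_acc k) \<le> 0" if "beta_acc k \<le> 0"
    by (rule mult_nonneg_nonpos[OF _ divide_nonneg_nonpos[OF norm_ge_zero that]])
      (rule order_trans[OF zero_le_one t_ge])
  then show ?thesis
    using pos by (meson not_less)
qed

lemma beta_outer_nonneg: "\<beta> k 0 \<ge> 0"
proof (cases k)
  case 0
  then show ?thesis using beta_init by simp
next
  case (Suc m)
  then show ?thesis
    using beta_next[of m] beta_acc_pos[of m] params by (simp add: beta_acc_def valid_params_def)
qed

section \<open>Vertical and horizontal steps and their model decreases\<close>

lemma J_v: "J (x k) *v v k = - \<alpha> k *\<^sub>R c (x k)"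
  unfolding v_def matrix_vector_mult_scaleR
  using full_row_rank_vertical_dir[of J "x k" c] full_row_rank[of k] by simp

lemma alpha_range:
  assumes "vertical_dir c J (x k) \<noteq> 0"
  shows "0 \<le> \<alpha> k" "\<alpha> k \<le> 1"
proof -
  have "0 \<le> theta P * sqrt (\<beta> k 0) / norm (vertical_dir c J (x k))"
    using params beta_outer_nonneg[of k] by (simp add: valid_params_def)
  then show "0 \<le> \<alpha> k" "\<alpha> k \<le> 1" using vertical[OF assms] by auto
qed

text \<open>The vertical step scales the linearized constraint by \<open>1 - \<alpha> k\<close>,
  which is nonnegative.\<close>

lemma DqN_eq:
  assumes "vertical_dir c J (x k) \<noteq> 0"
  shows "DqN k = \<alpha> k * norm (c (x k))"
proof -
  have "c (x k) + J (x k) *v v k = (1 - \<alpha> k) *\<^sub>R c (x k)"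
    by (simp add: J_v scaleR_left_diff_distrib)
  then have "norm (c (x k) + J (x k) *v v k) = (1 - \<alpha> k) * norm (c (x k))"
    using alpha_range[OF assms] by simp
  then show ?thesis
    unfolding DqN_def by (simp add: left_diff_distrib)
qed

text \<open>The direction solves the linearized constraint exactly, so it can vanish only at a
  feasible point. The case is separate because \<open>vertical\<close> then leaves
  \<open>\<alpha> k\<close> free.\<close>

lemma vertical_dir_zero:
  assumes "vertical_dir c J (x k) = 0"
  shows "c (x k) = 0" "v k = 0" "DqN k = 0"
  using full_row_rank_vertical_dir[of J "x k" c] full_row_rank[of k] assms
  by (auto simp: v_def DqN_def)

lemma DqN_nonneg: "DqN k \<ge> 0"
  using DqN_eq[of k] vertical_dir_zero[of k] alpha_range[of k] by fastforce

text \<open>Both sides carry the same factor \<open>\<alpha> k\<close>, so the bound passes from the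
  full direction to the step with the same constant.\<close>

lemma norm_v_le:
  assumes "norm (vertical_dir c J (x k)) \<le> \<kappa> * norm (c (x k))"
  shows "norm (v k) \<le> \<kappa> * DqN k"
proof (cases "vertical_dir c J (x k) = 0")
  case False
  have "norm (v k) = \<alpha> k * norm (vertical_dir c J (x k))"
    using alpha_range[OF False] by (simp add: v_def)
  also have "\<dots> \<le> \<alpha> k * (\<kappa> * norm (c (x k)))"
    using alpha_range[OF False] assms by (intro mult_left_mono)
  finally show ?thesis by (simp add: DqN_eq[OF False] mult_ac)
qed (simp add: vertical_dir_zero)

text \<open>By the Galerkin property the linear term equals the shifted quadratic form at
  \<open>u_acc k\<close>. Subtracting half of the unshifted form leaves half of the shifted form,
  nonnegative by \<open>curvature\<close>, plus the claimed bound.\<close>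

lemma DqH_ge: "DqH k (N k) \<ge> lambda k / 2 * (norm (u_acc k))\<^sup>2"
proof -
  let ?u = "u_acc k"
  have "(gZ k + (BZ k + mat (lambda k)) *v ?u) \<bullet> ?u = 0"
    unfolding u_acc_def u_def lambda_def by (rule cg_lanczos_residual_orthogonal[OF BZ_sym])
  then have "gZ k \<bullet> ?u = - (?u \<bullet> ((BZ k + mat (lambda k)) *v ?u))"
    using inner_commute[of ?u "(BZ k + mat (lambda k)) *v ?u"]
    by (simp add: inner_add_left eq_neg_iff_add_eq_0)
  moreover have "DqH k (N k) = - (gZ k \<bullet> ?u) - 1/2 * (?u \<bullet> (BZ k *v ?u))"
    unfolding DqH_def h_def gZ_def BZ_inner inner_transpose_mult u_acc_def by simp
  moreover have "?u \<bullet> ((BZ k + mat (lambda k)) *v ?u) = ?u \<bullet> (BZ k *v ?u) + lambda k * (norm ?u)\<^sup>2"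
    unfolding mat_add_mult by (simp add: inner_add_right dot_square_norm)
  ultimately show ?thesis using curvature[of k] by simp
qed

lemma DqH_nonneg: "DqH k (N k) \<ge> 0"
proof -
  have "0 \<le> lambda k / 2 * (norm (u_acc k))\<^sup>2"
    using shift_pos[of P] by (simp add: lambda_def less_imp_le)
  then show ?thesis using DqH_ge[of k] by linarith
qed

text \<open>The horizontal step lies in the null space of the Jacobian, so the penalty term sees
  only \<open>v k\<close>; the mixed quadratic term is contained in \<open>DqH\<close>.\<close>

lemma Dq_eq: "Dq k l = DqF k + DqH k l + mu_trial k l * DqN k"
proof -
  have "J (x k) *v d k l = J (x k) *v v k"
    unfolding d_def h_def matrix_vector_right_distrib using null_basis_props(1)[OF Z_basis] by simp
  moreover have "d k l \<bullet> (B k *v d k l) =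
      v k \<bullet> (B k *v v k) + 2 * ((B k *v v k) \<bullet> h k l) + h k l \<bullet> (B k *v h k l)"
    using inner_symmetric_mult[OF B_sym, of k "v k" "h k l"]
    by (simp add: d_def matrix_vector_right_distrib inner_add_left inner_add_right inner_commute)
  ultimately show ?thesis
    by (simp add: Dq_def qmodel_def DqF_def DqH_def DqN_def d_def algebra_simps inner_add_left inner_add_right)
qed

section \<open>Penalty parameter\<close>

lemma mu_step: "\<mu> (Suc k) = \<mu> k \<or> \<mu> k < mu_c k (N k) \<and> DqN k \<noteq> 0 \<and> \<mu> (Suc k) \<ge> \<mu> k + tau2 P"
  by (auto simp: mu_next mu_trial_def)

lemma mu_le_Suc: "\<mu> k \<le> \<mu> (Suc k)"
  using mu_step[of k] params by (auto simp: valid_params_def)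

lemma mu_ge_init: "\<mu> 0 \<le> \<mu> k"
  by (rule lift_Suc_mono_le[of \<mu>]) (auto intro: mu_le_Suc)

text \<open>The horizontal decrease can only lower the candidate, and \<open>DqN k\<close> cancels,
  which makes the bound independent of \<open>k\<close>.\<close>

lemma mu_c_le:
  assumes DqF: "\<bar>DqF k\<bar> \<le> C * DqN k" and nz: "DqN k \<noteq> 0"
  shows "mu_c k (N k) \<le> C / (1 - nu P)"
proof -
  have pos: "DqN k > 0" "1 - nu P > 0"
    using nz DqN_nonneg[of k] params by (auto simp: valid_params_def)
  have "mu_c k (N k) = (- DqF k - DqH k (N k)) / ((1 - nu P) * DqN k)"
    unfolding mu_c_def by (simp add: minus_divide_left)
  also have "\<dots> \<le> (C * DqN k) / ((1 - nu P) * DqN k)"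
    using DqF DqH_nonneg[of k] pos by (intro divide_right_mono) auto
  also have "\<dots> = C / (1 - nu P)" using pos by simp
  finally show ?thesis .
qed

lemma mu_eventually_const:
  assumes DqF: "\<And>k. \<bar>DqF k\<bar> \<le> C * DqN k"
  shows "\<exists>K. \<forall>k\<ge>K. \<mu> k = \<mu> K"
proof (rule ccontr)
  assume contra: "\<not> ?thesis"
  have mono: "\<mu> i \<le> \<mu> j" if "i \<le> j" for i j
    by (rule lift_Suc_mono_le[of \<mu>, OF mu_le_Suc that])
  have tau: "tau2 P > 0" using params by (simp add: valid_params_def)
  have inc: "\<exists>k\<ge>K. \<mu> (Suc k) \<noteq> \<mu> k" for K
  proof (rule ccontr)
    assume "\<not> ?thesis"
    then have step: "\<mu> (Suc k) = \<mu> k" if "k \<ge> K" for k using that by blast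
    have "\<mu> k = \<mu> K" if "k \<ge> K" for k
      using that by (induction rule: dec_induct) (auto simp: step)
    then show False using contra by blast
  qed
  have "\<exists>k. \<mu> k \<ge> \<mu> 0 + real m * tau2 P" for m
  proof (induction m)
    case (Suc m)
    then obtain k where k: "\<mu> k \<ge> \<mu> 0 + real m * tau2 P" by blast
    obtain l where l: "l \<ge> k" "\<mu> (Suc l) \<noteq> \<mu> l" using inc by blast
    then have "\<mu> (Suc l) \<ge> \<mu> k + tau2 P" using mu_step[of l] mono[of k l] by auto
    then show ?case using k by (intro exI[of _ "Suc l"]) (simp add: algebra_simps)
  qed auto
  \<comment> \<open>So many increases lift the parameter above the uniform bound on
    \<open>mu_c\<close>, after which none can be triggered.\<close>
  moreover obtain m where "real m * tau2 P > C / (1 - nu P)"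
    using reals_Archimedean3[OF tau] by blast
  ultimately obtain K where K: "\<mu> K > \<mu> 0 + C / (1 - nu P)"
    by (metis add_strict_left_mono less_le_trans)
  obtain k where k: "k \<ge> K" "\<mu> (Suc k) \<noteq> \<mu> k" using inc by blast
  then have "\<mu> k < C / (1 - nu P)"
    using mu_step[of k] mu_c_le[OF DqF, of k] by auto
  then show False using K mono[OF k(1)] mu_init by linarith
qed

text \<open>For nonzero \<open>DqN k\<close> this is the inequality
  \<open>mu_c k (N k) \<le> \<mu> (Suc k)\<close> with the denominator cleared. Otherwise
  \<open>v k\<close> vanishes and only the horizontal decrease is left.\<close>

lemma Dq_ge: "Dq k (N k) \<ge> nu P * \<mu> (Suc k) * DqN k"
proof (cases "DqN k = 0")
  case True
  then have "vertical_dir c J (x k) = 0 \<or> \<alpha> k = 0 \<or> c (x k) = 0"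
    using DqN_eq[of k] by auto
  then have "v k = 0"
    using vertical_dir_zero[of k] by (auto simp: v_def vertical_dir_def)
  then show ?thesis using True DqH_nonneg[of k] by (simp add: Dq_eq DqF_def)
next
  case False
  then have pos: "(1 - nu P) * DqN k > 0"
    using DqN_nonneg[of k] params by (auto simp: valid_params_def)
  have "mu_c k (N k) \<le> \<mu> (Suc k)"
    using False by (auto simp: mu_next mu_trial_def)
  then have "- (DqF k + DqH k (N k)) \<le> \<mu> (Suc k) * ((1 - nu P) * DqN k)"
    unfolding mu_c_def minus_divide_left using pos by (simp only: pos_divide_le_eq)
  then show ?thesis by (simp add: Dq_eq mu_next algebra_simps)
qed

section \<open>Decrease of the merit function\<close>

lemma Dq_nonneg: "Dq k (N k) \<ge> 0"
proof -
  have "0 \<le> nu P * \<mu> (Suc k) * DqN k"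
    using params mu_init mu_ge_init[of "Suc k"] DqN_nonneg[of k] by (simp add: valid_params_def)
  then show ?thesis using Dq_ge[of k] by linarith
qed

lemma merit_decrease:
  "merit f c (x k) (\<mu> (Suc k)) - merit f c (x (Suc k)) (\<mu> (Suc k)) \<ge> eta1 P * Dq k (N k)"
proof -
  have eta: "eta1 P > 0" using params by (simp add: valid_params_def)
  \<comment> \<open>With a zero denominator \<open>rho\<close> would be 0 and the trial would fail
    the acceptance test.\<close>
  have "Dq k (N k) \<noteq> 0"
    using accepted[of k] eta by (auto simp: rho_def)
  then show ?thesis
    using accepted[of k] Dq_nonneg[of k] by (simp add: rho_def x_next mu_next pos_le_divide_eq)
qed

lemma Dq_tendsto_0:
  assumes f: "bdd_below (range f)" and K: "\<And>k. k \<ge> K \<Longrightarrow> \<mu> k = \<mu> K"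
  shows "(\<lambda>k. Dq k (N k)) \<longlonglongrightarrow> 0"
proof -
  have eta: "eta1 P > 0" using params by (simp add: valid_params_def)
  \<comment> \<open>From \<open>K\<close> on all iterations use the same merit function, so their
    decreases telescope. The index \<open>Suc (k + K)\<close> below is that of the parameter used in
    iteration \<open>k + K\<close>.\<close>
  define \<psi> where "\<psi> k = merit f c (x (k + K)) (\<mu> K)" for k
  have dec: "\<psi> k - \<psi> (Suc k) \<ge> eta1 P * Dq (k + K) (N (k + K))" for k
    using merit_decrease[of "k + K"] K[of "Suc (k + K)"] by (simp add: \<psi>_def)
  have mu: "\<mu> k > 0" for k
    using mu_init mu_ge_init[of k] by linarith
  obtain m where m: "\<And>y. m \<le> f y" using f by (auto simp: bdd_below_def)
  have "convergent \<psi>"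
  proof (rule Bseq_monoseq_convergent)
    have "decseq \<psi>"
      using dec Dq_nonneg eta by (intro decseq_SucI) (smt (verit) mult_nonneg_nonneg)
    moreover have "m \<le> \<psi> k" for k
      using m[of "x (k + K)"] mu[of K] by (simp add: \<psi>_def merit_def add_increasing2)
    ultimately show "Bseq \<psi>" "monoseq \<psi>"
      by (auto simp: monoseq_iff intro!: decseq_bounded)
  qed
  then obtain L where L: "\<psi> \<longlonglongrightarrow> L" by (auto simp: convergent_def)
  have "(\<lambda>k. (\<psi> k - \<psi> (Suc k)) / eta1 P) \<longlonglongrightarrow> (L - L) / eta1 P"
    using L LIMSEQ_Suc[OF L] eta by (intro tendsto_intros) auto
  then have "(\<lambda>k. (\<psi> k - \<psi> (Suc k)) / eta1 P) \<longlonglongrightarrow> 0" by simp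
  then have "(\<lambda>k. Dq (k + K) (N (k + K))) \<longlonglongrightarrow> 0"
    by (rule tendsto_sandwich[OF _ _ tendsto_const, rotated 2])
       (use Dq_nonneg dec eta in \<open>auto simp: pos_le_divide_eq mult.commute\<close>)
  then show ?thesis by (rule LIMSEQ_offset)
qed

end


section \<open>Convergence of the reduced gradient\<close>

theorem theorem3:
  fixes f :: "real ^ 'n \<Rightarrow> real"
    and g :: "real ^ 'n \<Rightarrow> real ^ 'n"
    and c :: "real ^ ('n::finite) \<Rightarrow> real ^ ('p::finite)"
    and J :: "real ^ 'n \<Rightarrow> real ^ 'n ^ 'p"
    and P :: ssarc_params
    and I :: "'n set"
    and carry :: bool
    and x :: "nat \<Rightarrow> real ^ 'n"
    and B Z :: "nat \<Rightarrow> real ^ 'n ^ 'n"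
    and \<alpha> :: "nat \<Rightarrow> real"
    and \<beta> :: "nat \<Rightarrow> nat \<Rightarrow> real"
    and \<mu> :: "nat \<Rightarrow> real"
    and js :: "nat \<Rightarrow> nat \<Rightarrow> nat"
    and N :: "nat \<Rightarrow> nat"
    and t \<beta>max :: real
    and C :: "(real ^ 'n) set"
    and Lg Lc LJ \<kappa>B \<kappa>n :: real
  assumes dims: "CARD('p) \<le> CARD('n)"
    and f_deriv: "\<And>y. (f has_derivative (\<lambda>h. g y \<bullet> h)) (at y)"
    and c_deriv: "\<And>y. (c has_derivative (\<lambda>h. J y *v h)) (at y)"
    and C1: "continuous_on UNIV g" "continuous_on UNIV J"
    and run: "ssarc_standing P f g c J I carry x B Z \<alpha> \<beta> \<mu> js N t \<beta>max"
    and A1: "bdd_below (range f)" "bounded (range g)" "bounded (range c)"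
    and A2: "open C" "range x \<subseteq> C" "Lg-lipschitz_on C g" "Lc-lipschitz_on C c"
            "\<And>i. LJ-lipschitz_on C (\<lambda>y. J y $ i)"
    and A3: "\<kappa>B \<ge> 0" "\<And>k. onorm ((*v) (B k)) \<le> \<kappa>B"
    and A4: "\<kappa>n > 0" "\<And>k. norm (vertical_dir c J (x k)) \<le> \<kappa>n * norm (c (x k))"
    and A5: "\<And>ti li :: nat \<Rightarrow> nat. \<lbrakk>strict_mono ti; strict_mono li;
              (\<lambda>i. norm (x (ti i) - x (li i))) \<longlonglongrightarrow> 0\<rbrakk> \<Longrightarrow>
              (\<lambda>i. norm (transpose (Z (ti i)) *v g (x (ti i))
                       - transpose (Z (li i)) *v g (x (li i)))) \<longlonglongrightarrow> 0"
  shows "(\<lambda>k. norm (transpose (Z k) *v g (x k))) \<longlonglongrightarrow> 0"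
proof -
  interpret ssarc_standing P f g c J I carry x B Z \<alpha> \<beta> \<mu> js N t \<beta>max by (rule run)
  define n where "n = real CARD('n)"
  obtain G where G: "\<And>y. norm (g y) \<le> G" using A1(2) by (auto simp: bounded_iff)
  obtain M where M: "\<And>y. norm (c y) \<le> M" using A1(3) by (auto simp: bounded_iff)
  have G0: "G \<ge> 0" using G[of 0] norm_ge_zero[of "g 0"] by linarith
  have Bn: "norm (B k *v y) \<le> \<kappa>B * norm y" for k y
    by (rule order_trans[OF onorm[OF matrix_vector_mul_bounded_linear] mult_right_mono[OF A3(2)]]) simp
  have vN: "norm (v k) \<le> \<kappa>n * DqN k" for k by (rule norm_v_le[OF A4(2)])
  have vM: "norm (v k) \<le> \<kappa>n * M" for k
  proof -
    have "DqN k \<le> M" using M[of "x k"] norm_ge_zero[of "c (x k) + J (x k) *v v k"]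
      unfolding DqN_def by linarith
    then have "\<kappa>n * DqN k \<le> \<kappa>n * M" using A4(1) by simp
    then show ?thesis using vN[of k] by linarith
  qed
  \<comment> \<open>Bound on the gradient plus the Hessian applied to \<open>v k\<close>, using
    \<open>vM\<close>; the factor 1/2 of the quadratic term is dropped.\<close>
  define K1 where "K1 = G + \<kappa>B * (\<kappa>n * M)"
  have K1: "K1 \<ge> 0"
    using G0 A3(1) order_trans[OF norm_ge_zero vM] by (simp add: K1_def)
  have DqFv: "\<bar>DqF k\<bar> \<le> K1 * norm (v k)" for k
  proof -
    have "\<bar>g (x k) \<bullet> v k\<bar> \<le> G * norm (v k)"
      using Cauchy_Schwarz_ineq2[of "g (x k)" "v k"] mult_right_mono[OF G norm_ge_zero, of "x k" "v k"]
      by linarith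
    moreover have "\<bar>v k \<bullet> (B k *v v k)\<bar> \<le> \<kappa>B * (\<kappa>n * M) * norm (v k)"
    proof -
      have "norm (B k *v v k) \<le> \<kappa>B * (\<kappa>n * M)"
        using Bn[of k "v k"] mult_left_mono[OF vM A3(1), of k] by linarith
      then have "norm (v k) * norm (B k *v v k) \<le> norm (v k) * (\<kappa>B * (\<kappa>n * M))"
        by (rule mult_left_mono) simp
      then show ?thesis
        using Cauchy_Schwarz_ineq2[of "v k" "B k *v v k"] by (simp add: mult.commute)
    qed
    ultimately show ?thesis unfolding DqF_def K1_def by (simp add: distrib_right)
  qed
  have DqFN: "\<bar>DqF k\<bar> \<le> K1 * \<kappa>n * DqN k" for k
    using DqFv[of k] mult_left_mono[OF vN K1, of k] by (simp add: mult.assoc)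
  obtain K where K: "\<And>k. k \<ge> K \<Longrightarrow> \<mu> k = \<mu> K"
    using mu_eventually_const[OF DqFN] by blast
  have Dq0: "(\<lambda>k. Dq k (N k)) \<longlonglongrightarrow> 0" by (rule Dq_tendsto_0[OF A1(1) K])
  have mu0: "\<mu> k \<ge> \<mu> 0" for k by (rule mu_ge_init)
  have nu: "nu P > 0" using params by (simp add: valid_params_def)
  have DqN0: "DqN \<longlonglongrightarrow> 0"
  proof (rule tendsto_sandwich[OF _ _ tendsto_const])
    show "(\<lambda>k. Dq k (N k) / (nu P * \<mu> 0)) \<longlonglongrightarrow> 0"
      using tendsto_divide[OF Dq0 tendsto_const, of "nu P * \<mu> 0"] nu mu_init by simp
    \<comment> \<open>The initial penalty is a positive lower bound for all later ones, so
      \<open>DqN\<close> is controlled by the total decrease.\<close>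
    have "nu P * \<mu> 0 * DqN k \<le> nu P * \<mu> (Suc k) * DqN k" for k
      using nu mu0[of "Suc k"] DqN_nonneg[of k] by (intro mult_right_mono mult_left_mono) auto
    then have "nu P * \<mu> 0 * DqN k \<le> Dq k (N k)" for k
      using Dq_ge[of k] order_trans by blast
    then show "\<forall>\<^sub>F k in sequentially. DqN k \<le> Dq k (N k) / (nu P * \<mu> 0)"
      using nu mu_init by (simp add: pos_le_divide_eq mult.commute)
  qed (simp add: DqN_nonneg)
  have v0: "(\<lambda>k. norm (v k)) \<longlonglongrightarrow> 0"
    by (rule tendsto_sandwich[OF _ _ tendsto_const tendsto_mult_right_zero[OF DqN0, of \<kappa>n]])
      (auto simp: vN)
  have DqF0: "DqF \<longlonglongrightarrow> 0"
    by (rule Lim_null_comparison[OF _ tendsto_mult_right_zero[OF v0, of K1]]) (auto simp: DqFv)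
  have DqH0: "(\<lambda>k. DqH k (N k)) \<longlonglongrightarrow> 0"
  proof (rule tendsto_sandwich[OF _ _ tendsto_const])
    show "(\<lambda>k. Dq k (N k) - DqF k) \<longlonglongrightarrow> 0"
      using tendsto_diff[OF Dq0 DqF0] by simp
    have "DqH k (N k) \<le> Dq k (N k) - DqF k" for k
    proof -
      have "0 \<le> \<mu> (Suc k) * DqN k" using mu0[of "Suc k"] mu_init DqN_nonneg[of k] by simp
      then show ?thesis by (simp add: Dq_eq mu_next)
    qed
    then show "\<forall>\<^sub>F k in sequentially. DqH k (N k) \<le> Dq k (N k) - DqF k" by simp
  qed (simp add: DqH_nonneg)
  have u0: "(\<lambda>k. norm (u_acc k)) \<longlonglongrightarrow> 0"
  proof -
    have s0: "shift P 0 > 0" by (rule shift_pos)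
    \<comment> \<open>The smallest grid shift replaces \<open>lambda k\<close> to make the constant
      uniform.\<close>
    have "(norm (u_acc k))\<^sup>2 \<le> 2 / shift P 0 * DqH k (N k)" for k
    proof -
      have "shift P 0 / 2 * (norm (u_acc k))\<^sup>2 \<le> lambda k / 2 * (norm (u_acc k))\<^sup>2"
        using lambda_bounds(1)[of k] by (intro mult_right_mono) auto
      then have "shift P 0 / 2 * (norm (u_acc k))\<^sup>2 \<le> DqH k (N k)"
        using DqH_ge[of k] by linarith
      then show ?thesis using s0 by (simp add: field_simps del: shift.simps)
    qed
    then have "(\<lambda>k. (norm (u_acc k))\<^sup>2) \<longlonglongrightarrow> 0"
      by (intro tendsto_sandwich[OF _ _ tendsto_const tendsto_mult_right_zero[OF DqH0, of "2 / shift P 0"]])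
        auto
    then show ?thesis
      using tendsto_real_sqrt[of "\<lambda>k. (norm (u_acc k))\<^sup>2"] by fastforce
  qed
  \<comment> \<open>Uniform bound for the shifted reduced Hessian: one factor \<open>n\<close> for
    each of \<open>Z k\<close> and its transpose, plus the largest grid shift.\<close>
  define K2 where "K2 = n * (\<kappa>B * n) + shift P (max_shift P)"
  have n0: "n \<ge> 0" by (simp add: n_def)
  note Zn = null_basis_props(2,3)[OF Z_basis, folded n_def]
  have gZ_le: "norm (gZ k) \<le> xi P * norm (u_acc k) powr (1 + zeta P) + K2 * norm (u_acc k)" for k
  proof -
    let ?u = "u_acc k"
    have "norm (gZ k) \<le> norm (gZ k + (BZ k + mat (lambda k)) *v ?u) + norm ((BZ k + mat (lambda k)) *v ?u)"
      using norm_triangle_ineq4[of "gZ k + (BZ k + mat (lambda k)) *v ?u" "(BZ k + mat (lambda k)) *v ?u"]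
      by simp
    moreover have "xi P * min (norm (gZ k)) (norm ?u) powr (1 + zeta P) \<le> xi P * norm ?u powr (1 + zeta P)"
      using params by (intro mult_left_mono powr_mono2) (auto simp: valid_params_def)
    moreover have "norm ((BZ k + mat (lambda k)) *v ?u) \<le> K2 * norm ?u"
    proof -
      have "norm (BZ k *v ?u) \<le> n * (\<kappa>B * (n * norm ?u))"
        unfolding BZ_def matrix_vector_mul_assoc[symmetric]
        by (intro order_trans[OF Zn(1)] order_trans[OF Bn] mult_left_mono Zn(2) n0 A3(1))
      moreover have "norm (lambda k *\<^sub>R ?u) \<le> shift P (max_shift P) * norm ?u"
        using lambda_bounds[of k] shift_pos[of P 0] by (simp add: mult_right_mono del: shift.simps)
      ultimately show ?thesis
        using norm_triangle_ineq[of "BZ k *v ?u" "lambda k *\<^sub>R ?u"]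
        unfolding mat_add_mult K2_def by (simp add: algebra_simps)
    qed
    ultimately show ?thesis using residual[of k] by linarith
  qed
  have pow0: "(\<lambda>k. norm (u_acc k) powr (1 + zeta P)) \<longlonglongrightarrow> 0"
    using params by (intro tendsto_zero_powrI[OF u0 tendsto_const]) (auto simp: valid_params_def)
  have bound0: "(\<lambda>k. xi P * norm (u_acc k) powr (1 + zeta P) + K2 * norm (u_acc k)
      + n * (\<kappa>B * norm (v k))) \<longlonglongrightarrow> 0"
    by (intro tendsto_add_zero tendsto_mult_right_zero pow0 u0 v0)
  show ?thesis
  proof (rule tendsto_sandwich[OF _ _ tendsto_const bound0])
    \<comment> \<open>The reduced gradient differs from \<open>gZ k\<close> only by the reduced
      image of \<open>B k *v v k\<close>, which tends to 0 with the vertical step.\<close>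
    have "norm (transpose (Z k) *v g (x k)) \<le> norm (gZ k) + n * (\<kappa>B * norm (v k))" for k
    proof -
      have "transpose (Z k) *v g (x k) = gZ k - transpose (Z k) *v (B k *v v k)"
        unfolding gZ_def matrix_vector_right_distrib by simp
      moreover have "norm (transpose (Z k) *v (B k *v v k)) \<le> n * (\<kappa>B * norm (v k))"
        by (intro order_trans[OF Zn(1)] mult_left_mono Bn n0)
      ultimately show ?thesis
        using norm_triangle_ineq4[of "gZ k" "transpose (Z k) *v (B k *v v k)"]
        by (simp del: transpose_matrix_vector)
    qed
    then show "\<forall>\<^sub>F k in sequentially. norm (transpose (Z k) *v g (x k)) \<le>
        xi P * norm (u_acc k) powr (1 + zeta P) + K2 * norm (u_acc k) + n * (\<kappa>B * norm (v k))"
      using gZ_le by (intro always_eventually allI) (smt (verit))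
  qed (simp del: transpose_matrix_vector)
qed

end
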